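(* Let $n$ and $k$ be positive integers with $n\leq k\leq\binom{n}{2}+n$. Then, for integers $t$ with $2\leq t\leq n-1$, \[ g(n,k)= \begin{cases} k-n+t & \text{if } \binom{n-t}{2}+t(n-t-1)+n\leq k\leq \binom{n-t}{2}+t(n-t)+n-2,\\[2pt] k-n+t-1 & \text{if } k=\binom{n-t}{2}+t(n-t)+n-1,\\[2pt] \binom{n}{2}-1 & \text{if } k=\binom{n}{2}+n-1,\\[2pt] \binom{n}{2} & \text{if } k=\binom{n}{2}+n. \end{cases} \]
   Context: All graphs are finite, simple and undirected; $\binom{1}{2}=0$. A graph is total-colored if all its edges and all its vertices are assigned colors. A path in a total-colored graph is a total monochromatic path if all its edges and all its internal vertices have the same color. A total-coloring of a connected graph $G$ is a TMC-coloring if any two vertices of $G$ are joined by a total monochromatic path. The total monochromatic connection number $tmc(G)$ of a connected graph $G$ is the maximum number of colors used in a TMC-coloring of $G$. For positive integers $n,k$, $g(n,k)$ denotes the maximum integer such that every connected graph $G$ of order $n$ with $|E(G)|\leq g(n,k)$ satisfies $tmc(G)\leq k$. *)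

theory Defs
  imports Complex_Main
begin

definition simple_graph :: "'a set \<Rightarrow> 'a set set \<Rightarrow> bool" where
  "simple_graph V E \<longleftrightarrow> finite V \<and> (\<forall>e\<in>E. e \<subseteq> V \<and> card e = 2)"

definition is_path :: "'a set \<Rightarrow> 'a set set \<Rightarrow> 'a \<Rightarrow> 'a \<Rightarrow> 'a list \<Rightarrow> bool" where
  "is_path V E u v p \<longleftrightarrow>
     p \<noteq> [] \<and> hd p = u \<and> last p = v \<and> distinct p \<and> set p \<subseteq> V \<and>
     (\<forall>i. Suc i < length p \<longrightarrow> {p ! i, p ! Suc i} \<in> E)"

definition path_edges :: "'a list \<Rightarrow> 'a set set" where
  "path_edges p = {{p ! i, p ! Suc i} |i. Suc i < length p}"

definition internal_vertices :: "'a list \<Rightarrow> 'a set" where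
  "internal_vertices p = set (butlast (tl p))"

definition connected_graph :: "'a set \<Rightarrow> 'a set set \<Rightarrow> bool" where
  "connected_graph V E \<longleftrightarrow>
     simple_graph V E \<and> V \<noteq> {} \<and> (\<forall>u\<in>V. \<forall>v\<in>V. \<exists>p. is_path V E u v p)"

(* A total-coloring is a pair of maps: ce colors the edges and cv colors the vertices, both from
   the same palette. *)

definition total_monochromatic :: "('a set \<Rightarrow> nat) \<Rightarrow> ('a \<Rightarrow> nat) \<Rightarrow> 'a list \<Rightarrow> bool" where
  "total_monochromatic ce cv p \<longleftrightarrow>
     (\<exists>c. (\<forall>e\<in>path_edges p. ce e = c) \<and> (\<forall>x\<in>internal_vertices p. cv x = c))"

definition TMC_coloring ::
  "'a set \<Rightarrow> 'a set set \<Rightarrow> ('a set \<Rightarrow> nat) \<Rightarrow> ('a \<Rightarrow> nat) \<Rightarrow> bool" where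
  "TMC_coloring V E ce cv \<longleftrightarrow>
     (\<forall>u\<in>V. \<forall>v\<in>V. \<exists>p. is_path V E u v p \<and> total_monochromatic ce cv p)"

(* The set below is bounded by card E + card V, and nonempty if the graph is connected. *)

definition tmc :: "'a set \<Rightarrow> 'a set set \<Rightarrow> nat" where
  "tmc V E = Max {card (ce ` E \<union> cv ` V) |ce cv. TMC_coloring V E ce cv}"

(* Vertices are natural numbers; up to isomorphism this covers all finite graphs.
   The candidates m are limited to the possible edge counts of a graph of order n: without this,
   no maximum exists for k \<ge> (n choose 2) + n, where every m qualifies. *)

definition g :: "nat \<Rightarrow> nat \<Rightarrow> nat" where
  "g n k = Max {m. m \<le> n choose 2 \<and>
     (\<forall>(V :: nat set) E. connected_graph V E \<and> card V = n \<and> card E \<le> m \<longrightarrow> tmc V E \<le> k)}"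

end

theory Submission
  imports Defs
begin

text \<open>
  Consider a TMC-coloring with \<open>q\<close> colors of a connected graph with \<open>n\<close> vertices and \<open>m\<close> edges. Every
  non-adjacent pair is joined by a path inside one color class whose color also occurs on a vertex.
  A set of \<open>a\<close> edges connects at most \<open>a choose 2\<close> pairs other than its own edges, and \<open>x choose 2\<close>
  is superadditive, so at most \<open>A choose 2\<close> pairs are non-adjacent, where \<open>A\<close> counts the edges whose
  color occurs on a vertex. As \<open>q \<le> n + (m - A)\<close>, this yields
  \<open>(n choose 2) - m \<le> (m + n - q) choose 2\<close>. Conversely, delete \<open>s \<le> t choose 2\<close> edges inside a
  \<open>t\<close>-set of a complete graph, and give one color to a star joining this set to a further vertex and
  to the center of that star, and distinct colors to everything else: this uses \<open>m + n - t\<close> colors.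
  So the bound is sharp, and \<open>g\<close> is read off from it.
\<close>

section \<open>Binomial coefficients\<close>

lemma choose_two_Suc: "Suc a choose 2 = a + (a choose 2)"
  by (simp add: numeral_2_eq_2)

lemma choose_two_add: "(a + b) choose 2 = (a choose 2) + a * b + (b choose 2)"
  by (induction b) (simp_all add: choose_two_Suc)

lemma choose_two_mono: "a \<le> b \<Longrightarrow> a choose 2 \<le> b choose 2"
  by (auto simp: le_iff_add choose_two_add)

lemma sum_choose_two_le:
  "finite S \<Longrightarrow> (\<Sum>c\<in>S. f c choose 2) \<le> (\<Sum>c\<in>S. f c) choose 2"
  by (induction S rule: finite_induct) (simp_all add: choose_two_add)

section \<open>Pairs connected by a set of edges\<close>

definition adj_rel :: "'a set set \<Rightarrow> ('a \<times> 'a) set" where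
  "adj_rel F = {(x, y). {x, y} \<in> F}"

text \<open>A stand-in for a spanning forest: for finite \<open>F\<close>, each component
  contributes its size minus one, and no set of components has to be formed.\<close>

definition nonmin :: "'a::linorder set set \<Rightarrow> 'a set" where
  "nonmin F = {v. \<exists>u<v. (u, v) \<in> (adj_rel F)\<^sup>*}"

definition connected_pairs :: "'a::linorder set set \<Rightarrow> 'a set set" where
  "connected_pairs F = {{u, v} |u v. u < v \<and> (u, v) \<in> (adj_rel F)\<^sup>*}"

lemma sym_adj_rel_rtrancl: "sym ((adj_rel F)\<^sup>*)"
  by (rule sym_rtrancl) (auto simp: sym_def adj_rel_def insert_commute)

lemma adj_rel_rtrancl_commute: "(u, v) \<in> (adj_rel F)\<^sup>* \<longleftrightarrow> (v, u) \<in> (adj_rel F)\<^sup>*"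
  using sym_adj_rel_rtrancl by (metis symD)

lemma adj_rel_rtrancl_join:
  assumes "(u, w) \<in> (adj_rel F)\<^sup>*" and "(v, w) \<in> (adj_rel F)\<^sup>*"
  shows "(u, v) \<in> (adj_rel F)\<^sup>*"
  using assms(1) symD[OF sym_adj_rel_rtrancl assms(2)] by (rule rtrancl_trans)

lemma adj_rel_insert:
  "adj_rel (insert {x, y} F) = insert (x, y) (insert (y, x) (adj_rel F))"
  by (auto simp: adj_rel_def doubleton_eq_iff)

text \<open>A connection that exists only after adding the edge must cross it, so its ends lie in
  the old components of \<open>x\<close> and \<open>y\<close>, one in each.\<close>

lemma adj_rel_rtrancl_insertD:
  assumes "(u, v) \<in> (adj_rel (insert {x, y} F))\<^sup>*" and "(u, v) \<notin> (adj_rel F)\<^sup>*"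
  shows "(v, x) \<in> (adj_rel F)\<^sup>* \<and> (u, y) \<in> (adj_rel F)\<^sup>*
    \<or> (v, y) \<in> (adj_rel F)\<^sup>* \<and> (u, x) \<in> (adj_rel F)\<^sup>*"
proof -
  have "(x, y) \<in> (adj_rel F)\<^sup>* \<Longrightarrow> (u, x) \<in> (adj_rel F)\<^sup>* \<Longrightarrow> (y, v) \<in> (adj_rel F)\<^sup>* \<Longrightarrow> False"
    using assms(2) by (meson rtrancl_trans)
  with assms show ?thesis
    unfolding adj_rel_insert rtrancl_insert
    by (auto simp: adj_rel_rtrancl_commute[of v] dest: rtrancl_trans)
qed

text \<open>A new edge merges at most two components, and only the larger of their two minima stops
  being a minimum.\<close>

lemma nonmin_insert:
  assumes v: "v \<in> nonmin (insert {x, y} F)" "v \<notin> nonmin F"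
    and w: "w \<in> nonmin (insert {x, y} F)" "w \<notin> nonmin F"
  shows "v = w"
proof -
  let ?R = "(adj_rel F)\<^sup>*"
  have min: "a \<le> b" if "a \<notin> nonmin F" "(a, z) \<in> ?R" "(b, z) \<in> ?R" for a b z
  proof -
    have "(b, a) \<in> ?R"
      using that(3,2) by (rule adj_rel_rtrancl_join)
    then show ?thesis
      using that by (auto simp: nonmin_def not_less)
  qed
  have split: "\<exists>a<z. (z, x) \<in> ?R \<and> (a, y) \<in> ?R \<or> (z, y) \<in> ?R \<and> (a, x) \<in> ?R"
    if z: "z \<in> nonmin (insert {x, y} F)" "z \<notin> nonmin F" for z
  proof -
    obtain a where a: "a < z" "(a, z) \<in> (adj_rel (insert {x, y} F))\<^sup>*"
      using z(1) by (auto simp: nonmin_def)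
    have "(a, z) \<notin> ?R"
      using z(2) a(1) by (auto simp: nonmin_def)
    then show ?thesis
      using adj_rel_rtrancl_insertD[OF a(2)] a(1) by (intro exI[of _ a]) simp
  qed
  obtain a where a: "a < v" "(v, x) \<in> ?R \<and> (a, y) \<in> ?R \<or> (v, y) \<in> ?R \<and> (a, x) \<in> ?R"
    using split[OF v] by blast
  obtain b where b: "b < w" "(w, x) \<in> ?R \<and> (b, y) \<in> ?R \<or> (w, y) \<in> ?R \<and> (b, x) \<in> ?R"
    using split[OF w] by blast
  \<comment> \<open>Either \<open>v\<close> and \<open>w\<close> are minima of the same old
    component, or each lies in the component of the other's smaller witness, which would force the
    cycle \<open>v \<le> b < w \<le> a < v\<close>.\<close>
  consider z where "(v, z) \<in> ?R" "(w, z) \<in> ?R"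
    | z z' where "(v, z) \<in> ?R" "(b, z) \<in> ?R" "(w, z') \<in> ?R" "(a, z') \<in> ?R"
    using a(2) b(2) by blast
  then show ?thesis
  proof cases
    case 1
    then show ?thesis
      using min[OF v(2)] min[OF w(2)] by (intro antisym)
  next
    case 2
    then have "v \<le> b" "w \<le> a"
      using min[OF v(2)] min[OF w(2)] by blast+
    then show ?thesis
      using a(1) b(1) by order
  qed
qed

text \<open>When the edges are added one at a time, each contributes at most one vertex by
  \<open>nonmin_insert\<close>.\<close>

lemma card_nonmin_le:
  assumes "finite F" and "\<forall>e\<in>F. card e = 2"
  shows "finite (nonmin F) \<and> card (nonmin F) \<le> card F"
  using assms
proof (induction F rule: finite_induct)
  case empty
  have "adj_rel ({} :: 'a set set) = {}" by (simp add: adj_rel_def)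
  then show ?case by (simp add: nonmin_def)
next
  case (insert e F)
  obtain x y where e: "e = {x, y}"
    using insert.prems by (auto simp: card_2_iff)
  have IH: "finite (nonmin F)" "card (nonmin F) \<le> card F"
    using insert by auto
  have "\<exists>a. nonmin (insert e F) \<subseteq> insert a (nonmin F)"
    using nonmin_insert[of _ x y F] unfolding e by blast
  then obtain a where a: "nonmin (insert e F) \<subseteq> insert a (nonmin F)" ..
  then have "card (nonmin (insert e F)) \<le> card (insert a (nonmin F))"
    using IH by (intro card_mono) auto
  also have "\<dots> \<le> Suc (card (nonmin F))"
    using IH by (simp add: card_insert_if)
  finally show ?case
    using IH insert.hyps a by (auto intro: finite_subset)
qed

text \<open>
  A connected pair \<open>{u, v}\<close> is determined by \<open>{u, v} \<inter> nonmin F\<close>: the only vertex of a component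
  outside \<open>nonmin F\<close> is its minimum.
\<close>

lemma card_connected_pairs_le:
  assumes "finite F" and "\<forall>e\<in>F. card e = 2"
  shows "finite (connected_pairs F) \<and> card (connected_pairs F) \<le> Suc (card F) choose 2"
proof -
  let ?R = "(adj_rel F)\<^sup>*" and ?N = "nonmin F"
  let ?T = "{A. A \<subseteq> ?N \<and> card A = 1} \<union> {A. A \<subseteq> ?N \<and> card A = 2}"
  have N: "finite ?N" "card ?N \<le> card F"
    using card_nonmin_le[OF assms] by auto
  have less_nonmin: "v \<in> ?N" if "u < v" "(u, v) \<in> ?R" for u v
    using that by (auto simp: nonmin_def)
  have unique: "u = u'" if "(u, v) \<in> ?R" "(u', v) \<in> ?R" "u \<notin> ?N" "u' \<notin> ?N" for u u' v
  proof -
    have "(u, u') \<in> ?R" "(u', u) \<in> ?R"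
      using that(1,2) that(2,1) by (auto intro: adj_rel_rtrancl_join)
    then show ?thesis
      using that less_nonmin by (cases u u' rule: linorder_cases) auto
  qed
  have inj: "inj_on (\<lambda>p. p \<inter> ?N) (connected_pairs F)"
  proof (rule inj_onI)
    fix p p' assume "p \<in> connected_pairs F" "p' \<in> connected_pairs F" and eq: "p \<inter> ?N = p' \<inter> ?N"
    then obtain u v u' v' where p: "p = {u, v}" "u < v" "(u, v) \<in> ?R"
      and p': "p' = {u', v'}" "u' < v'" "(u', v') \<in> ?R"
      by (auto simp: connected_pairs_def)
    have "v \<in> ?N" "v' \<in> ?N"
      using p p' less_nonmin by auto
    \<comment> \<open>Equal traces have equal size: with two elements they are the pairs themselves,
      with one they give \<open>v = v'\<close>, and \<open>unique\<close> identifies the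
      minima.\<close>
    then show "p = p'"
      using p p' eq unique[of u v u'] by (cases "u \<in> ?N"; cases "u' \<in> ?N") auto
  qed
  have sub: "(\<lambda>p. p \<inter> ?N) ` connected_pairs F \<subseteq> ?T"
  proof
    fix q assume "q \<in> (\<lambda>p. p \<inter> ?N) ` connected_pairs F"
    then obtain u v where q: "q = {u, v} \<inter> ?N" "u < v" "(u, v) \<in> ?R"
      by (auto simp: connected_pairs_def)
    have "v \<in> ?N" using q less_nonmin by auto
    then show "q \<in> ?T"
      using q by (cases "u \<in> ?N") auto
  qed
  have fin: "finite ?T" using N by auto
  have "card ?T \<le> card {A. A \<subseteq> ?N \<and> card A = 1} + card {A. A \<subseteq> ?N \<and> card A = 2}"
    by (rule card_Un_le)
  also have "\<dots> = Suc (card ?N) choose 2"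
    using N by (simp add: n_subsets choose_two_Suc)
  also have "\<dots> \<le> Suc (card F) choose 2"
    using N by (intro choose_two_mono) simp
  finally show ?thesis
    using inj_on_finite[OF inj sub fin] card_inj_on_le[OF inj sub fin] by simp
qed

lemma ordered_pair_if_card_2:
  fixes e :: "'a::linorder set"
  assumes "card e = 2"
  obtains u v where "e = {u, v}" "u < v"
proof -
  obtain x y where "e = {x, y}" "x \<noteq> y"
    using assms by (auto simp: card_2_iff)
  then show ?thesis
    using that[of x y] that[of y x] by (cases x y rule: linorder_cases) (auto simp: insert_commute)
qed

text \<open>The edges of \<open>F\<close> are themselves connected pairs, and taking
  \<open>card F\<close> from \<open>Suc (card F) choose 2\<close> leaves
  \<open>card F choose 2\<close>.\<close>

lemma card_connected_nonadjacent_le: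
  assumes "finite F" and "\<forall>e\<in>F. card e = 2"
  shows "finite (connected_pairs F - F) \<and> card (connected_pairs F - F) \<le> card F choose 2"
proof -
  have "F \<subseteq> connected_pairs F"
  proof
    fix e assume e: "e \<in> F"
    then obtain u v where "e = {u, v}" "u < v"
      using assms ordered_pair_if_card_2 by metis
    with e show "e \<in> connected_pairs F"
      by (auto simp: connected_pairs_def adj_rel_def)
  qed
  then have "card (connected_pairs F - F) = card (connected_pairs F) - card F"
    using assms by (intro card_Diff_subset) auto
  then show ?thesis
    using card_connected_pairs_le[OF assms] by (auto simp: choose_two_Suc)
qed

lemma path_adj_rel_rtrancl:
  assumes "p \<noteq> []" and "\<forall>i. Suc i < length p \<longrightarrow> {p ! i, p ! Suc i} \<in> F"
  shows "(hd p, last p) \<in> (adj_rel F)\<^sup>*"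
  using assms
proof (induction p)
  case (Cons x p)
  show ?case
  proof (cases p)
    case Nil
    then show ?thesis by simp
  next
    case (Cons y p')
    have "{x, y} \<in> F"
      using Cons.prems(2)[rule_format, of 0] Cons by simp
    moreover have "(hd p, last p) \<in> (adj_rel F)\<^sup>*"
    proof (rule Cons.IH)
      show "p \<noteq> []" using Cons by simp
      show "\<forall>i. Suc i < length p \<longrightarrow> {p ! i, p ! Suc i} \<in> F"
        using Cons.prems(2) by (metis Suc_less_eq length_Cons nth_Cons_Suc)
    qed
    ultimately show ?thesis
      using Cons by (auto simp: adj_rel_def intro: converse_rtrancl_into_rtrancl)
  qed
qed simp

section \<open>An upper bound for the number of colors\<close>

lemma simple_graph_finite_edges: "simple_graph V E \<Longrightarrow> finite E"
  unfolding simple_graph_def by (meson Pow_iff finite_Pow_iff finite_subset subsetI)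

text \<open>Nonadjacent ends force an internal vertex on the monochromatic path, so the color of its
  edges also occurs on a vertex.\<close>

lemma nonadjacent_connected_in_color:
  fixes V :: "'a::linorder set"
  assumes col: "TMC_coloring V E ce cv"
    and e: "e \<subseteq> V" "card e = 2" "e \<notin> E"
  shows "\<exists>c\<in>cv ` V. e \<in> connected_pairs {f\<in>E. ce f = c}"
proof -
  obtain u v where uv: "e = {u, v}" "u < v"
    using e(2) by (rule ordered_pair_if_card_2)
  then obtain p where p: "is_path V E u v p" "total_monochromatic ce cv p"
    using col e by (auto simp: TMC_coloring_def)
  then obtain c where c: "\<forall>f\<in>path_edges p. ce f = c" "\<forall>x\<in>internal_vertices p. cv x = c"
    by (auto simp: total_monochromatic_def)
  obtain w q where pwq: "p = u # w # q" "q \<noteq> []"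
  proof -
    obtain r where r: "p = u # r"
      using p(1) by (cases p) (auto simp: is_path_def)
    moreover obtain w q where wq: "r = w # q"
      using p(1) r uv by (cases r) (auto simp: is_path_def)
    moreover have "q \<noteq> []"
    proof
      assume "q = []"
      then have "w = v" "{u, w} \<in> E" using p(1) r wq by (auto simp: is_path_def)
      then show False using e uv by simp
    qed
    ultimately show ?thesis using that by blast
  qed
  have "w \<in> V" "cv w = c"
    using pwq p(1) c(2) by (auto simp: is_path_def internal_vertices_def)
  moreover have "(hd p, last p) \<in> (adj_rel {f\<in>E. ce f = c})\<^sup>*"
    using p(1) c(1) by (intro path_adj_rel_rtrancl) (auto simp: is_path_def path_edges_def)
  ultimately show ?thesis
    using uv p(1) by (auto simp: is_path_def connected_pairs_def)
qed

lemma TMC_coloring_colors_le: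
  assumes "simple_graph V E"
  shows "card (ce ` E \<union> cv ` V) \<le> card E + card V"
proof -
  have "card (ce ` E) \<le> card E" "card (cv ` V) \<le> card V"
    using assms simple_graph_finite_edges[OF assms]
    by (auto intro: card_image_le simp: simple_graph_def)
  then show ?thesis
    using card_Un_le[of "ce ` E" "cv ` V"] by linarith
qed

theorem TMC_coloring_missing_edges_le:
  fixes V :: "'a::linorder set"
  assumes G: "simple_graph V E" and col: "TMC_coloring V E ce cv"
  shows "card V choose 2
    \<le> card E + ((card E + card V - card (ce ` E \<union> cv ` V)) choose 2)"
proof -
  let ?C = "cv ` V" and ?K = "{e. e \<subseteq> V \<and> card e = 2}"
  let ?F = "\<lambda>c. {e\<in>E. ce e = c}"
  let ?A = "{e\<in>E. ce e \<in> ?C}"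
  have V: "finite V" and E: "finite E" and EK: "E \<subseteq> ?K"
    using G simple_graph_finite_edges by (auto simp: simple_graph_def)
  have F: "finite (?F c)" "\<forall>e\<in>?F c. card e = 2" for c
    using E EK by auto
  have K: "card ?K = card V choose 2" "finite ?K"
    using V by (auto simp: n_subsets)
  \<comment> \<open>Each missing pair is charged to a color that occurs on a vertex; the bound then
    adds up over these color classes.\<close>
  have "?K - E \<subseteq> (\<Union>c\<in>?C. connected_pairs (?F c) - ?F c)"
  proof
    fix e assume e: "e \<in> ?K - E"
    then obtain c where "c \<in> ?C" "e \<in> connected_pairs (?F c)"
      using nonadjacent_connected_in_color[OF col, of e] by auto
    then show "e \<in> (\<Union>c\<in>?C. connected_pairs (?F c) - ?F c)"
      using e by (intro UN_I[of c]) auto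
  qed
  then have "card (?K - E) \<le> card (\<Union>c\<in>?C. connected_pairs (?F c) - ?F c)"
    using V card_connected_nonadjacent_le[OF F] by (intro card_mono) auto
  also have "\<dots> \<le> (\<Sum>c\<in>?C. card (connected_pairs (?F c) - ?F c))"
    using V by (intro card_UN_le) auto
  also have "\<dots> \<le> (\<Sum>c\<in>?C. card (?F c) choose 2)"
    using card_connected_nonadjacent_le[OF F] by (intro sum_mono) blast
  also have "\<dots> \<le> (\<Sum>c\<in>?C. card (?F c)) choose 2"
    using V by (intro sum_choose_two_le) auto
  also have "(\<Sum>c\<in>?C. card (?F c)) = card (\<Union>c\<in>?C. ?F c)"
    using V E by (intro card_UN_disjoint[symmetric]) auto
  also have "(\<Union>c\<in>?C. ?F c) = ?A"
    by auto
  finally have missing: "card (?K - E) \<le> card ?A choose 2" .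
  \<comment> \<open>Edges in \<open>?A\<close> bring no color beyond those of the vertices.\<close>
  have "card (ce ` E \<union> ?C) = card (ce ` (E - ?A) \<union> ?C)"
    by (rule arg_cong[of _ _ card]) auto
  also have "\<dots> \<le> card (ce ` (E - ?A)) + card ?C"
    by (rule card_Un_le)
  also have "\<dots> \<le> card (E - ?A) + card V"
    using V E by (intro add_mono card_image_le) auto
  also have "card (E - ?A) = card E - card ?A"
    using E by (intro card_Diff_subset) auto
  finally have "card ?A \<le> card E + card V - card (ce ` E \<union> ?C)"
    using card_mono[OF E, of ?A] by auto
  then have "card (?K - E) \<le> (card E + card V - card (ce ` E \<union> ?C)) choose 2"
    using missing choose_two_mono order_trans by blast
  moreover have "card (?K - E) = (card V choose 2) - card E"
    using E EK K by (simp add: card_Diff_subset)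
  ultimately show ?thesis by simp
qed

section \<open>The extremal graphs\<close>

lemma finite_color_counts:
  assumes "simple_graph V E"
  shows "finite {card (ce ` E \<union> cv ` V) |ce cv. TMC_coloring V E ce cv}"
  by (rule finite_subset[of _ "{..card E + card V}"])
    (auto intro: TMC_coloring_colors_le[OF assms])

lemma tmc_le:
  assumes G: "connected_graph V E"
    and le: "\<And>ce cv. TMC_coloring V E ce cv \<Longrightarrow> card (ce ` E \<union> cv ` V) \<le> k"
  shows "tmc V E \<le> k"
proof -
  \<comment> \<open>One color everywhere is a TMC-coloring by connectedness, so the
    \<open>Max\<close> in \<open>tmc\<close> is taken over a nonempty set.\<close>
  have "TMC_coloring V E (\<lambda>_. 0) (\<lambda>_. 0)"
    using G by (auto simp: TMC_coloring_def connected_graph_def total_monochromatic_def)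
  then show ?thesis
    using G le finite_color_counts[of V E] unfolding tmc_def
    by (intro Max.boundedI) (auto simp: connected_graph_def)
qed

lemma tmc_ge:
  assumes "simple_graph V E" and "TMC_coloring V E ce cv"
  shows "card (ce ` E \<union> cv ` V) \<le> tmc V E"
  unfolding tmc_def using assms by (intro Max_ge finite_color_counts) auto

text \<open>Here \<open>s\<close> edges are deleted inside a set of size \<open>t\<close>. Merging
  the colors of \<open>t\<close> star edges with that of the center costs \<open>t\<close> of the
  \<open>card E + n\<close> possible colors.\<close>

lemma exists_graph_with_large_tmc:
  assumes t: "t < n" and s: "s \<le> t choose 2"
  shows "\<exists>(V :: nat set) E. connected_graph V E \<and> card V = n \<and> card E = (n choose 2) - s
    \<and> card E + n - t \<le> tmc V E"
proof -
  define V where "V = {..<n}"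
  define K where "K = {e. e \<subseteq> V \<and> card e = 2}"
  have V: "finite V" "card V = n" "t \<in> V"
    using t by (auto simp: V_def)
  have K: "finite K" "card K = n choose 2"
    using V by (auto simp: K_def n_subsets)
  have "card {e. e \<subseteq> {..<t} \<and> card e = 2} = t choose 2"
    by (simp add: n_subsets)
  with s obtain M where M: "M \<subseteq> {e. e \<subseteq> {..<t} \<and> card e = 2}" "card M = s" "finite M"
    using obtain_subset_with_card_n[of s "{e. e \<subseteq> {..<t} \<and> card e = 2}"] by auto
  define E where "E = K - M"
  have "M \<subseteq> K"
    using M t by (fastforce simp: K_def V_def)
  then have E: "finite E" "card E = (n choose 2) - s"
    using K M by (auto simp: E_def card_Diff_subset)
  have G: "simple_graph V E"
    using V by (auto simp: simple_graph_def E_def K_def)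
  \<comment> \<open>The center is vertex \<open>t\<close> itself: it lies outside
    \<open>{..<t}\<close>, so no edge at it was deleted.\<close>
  define S where "S = (\<lambda>i. {i, t}) ` {..<t}"
  have "inj_on (\<lambda>i. {i, t}) {..<t}"
    by (auto simp: inj_on_def doubleton_eq_iff)
  then have cardS: "card S = t"
    by (simp add: S_def card_image)
  have S: "S \<subseteq> E"
    using t M by (auto simp: S_def E_def K_def V_def)
  \<comment> \<open>Representatives of the color classes: each edge off the star and each vertex,
    where \<open>Inr t\<close> also stands for the whole star.\<close>
  define X where "X = Inl ` (E - S) \<union> Inr ` V"
  have "finite (Inl ` E \<union> Inr ` V :: (nat set + nat) set)"
    using E V by simp
  then obtain f :: "nat set + nat \<Rightarrow> nat" where f: "inj_on f (Inl ` E \<union> Inr ` V)"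
    using finite_imp_inj_to_nat_seg[of "Inl ` E \<union> Inr ` V :: (nat set + nat) set"] by auto
  define ce where "ce e = (if e \<in> S then f (Inr t) else f (Inl e))" for e
  define cv where "cv v = f (Inr v)" for v
  have path: "\<exists>p. is_path V E u v p \<and> total_monochromatic ce cv p" if "u \<in> V" "v \<in> V" for u v
  proof -
    have "u \<noteq> v \<Longrightarrow> {u, v} \<notin> M \<Longrightarrow> {u, v} \<in> E"
      using that by (simp add: E_def K_def)
    then consider "u = v" | "u \<noteq> v" "{u, v} \<in> E" | "u \<noteq> v" "{u, v} \<in> M"
      by blast
    then show ?thesis
    proof cases
      case 1
      then show ?thesis
        using that by (intro exI[of _ "[u]"])
          (auto simp: is_path_def total_monochromatic_def path_edges_def internal_vertices_def)
    next
      case 2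
      then show ?thesis
        using that by (intro exI[of _ "[u, v]"])
          (auto simp: is_path_def total_monochromatic_def path_edges_def internal_vertices_def)
    next
      \<comment> \<open>Deleted pairs lie in \<open>{..<t}\<close> and are joined through
        \<open>t\<close> along two star edges, whose color is that of \<open>t\<close>.\<close>
      case 3
      then have "u < t" "v < t"
        using M by auto
      then have uv: "{u, t} \<in> S" "{t, v} \<in> S" "u \<noteq> t" "v \<noteq> t"
        by (auto simp: S_def insert_commute)
      have steps: "Suc i < length [u, t, v] \<longleftrightarrow> i = 0 \<or> i = 1" for i
        by auto
      have "path_edges [u, t, v] \<subseteq> {{u, t}, {t, v}}"
        unfolding path_edges_def steps by auto
      then have "total_monochromatic ce cv [u, t, v]"
        using uv by (auto simp: total_monochromatic_def internal_vertices_def ce_def cv_def)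
      moreover have "is_path V E u v [u, t, v]"
        unfolding is_path_def steps using uv 3 that S V by auto
      ultimately show ?thesis by blast
    qed
  qed
  then have col: "TMC_coloring V E ce cv"
    by (auto simp: TMC_coloring_def)
  have conn: "connected_graph V E"
    using G path V by (auto simp: connected_graph_def)
  have "ce ` E \<union> cv ` V = f ` X"
    using S V by (auto simp: X_def ce_def cv_def image_iff)
  moreover have "card (f ` X) = card X"
    by (intro card_image inj_on_subset[OF f]) (auto simp: X_def)
  moreover have "card X = card (E - S) + n"
    using V E card_Plus[of "E - S" V] by (simp add: X_def Plus_def)
  moreover have "card (E - S) = card E - t" "t \<le> card E"
    using S E(1) cardS finite_subset[OF S] card_mono[OF E(1) S] by (simp_all add: card_Diff_subset)
  ultimately have "card E + n - t \<le> tmc V E"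
    using tmc_ge[OF G col] by simp
  then show ?thesis
    using conn V E by blast
qed

section \<open>The value of g\<close>

text \<open>The condition in \<open>g\<close> covers all graphs with at most \<open>m\<close> edges,
  so one bad graph with \<open>Suc m\<close> edges rules out every larger candidate; at
  \<open>m = n choose 2\<close> the cap in \<open>g\<close> does so.\<close>

lemma g_eqI:
  assumes "m \<le> n choose 2"
    and upper: "\<And>(V :: nat set) E. connected_graph V E \<Longrightarrow> card V = n \<Longrightarrow> card E \<le> m \<Longrightarrow> tmc V E \<le> k"
    and lower: "m < n choose 2 \<Longrightarrow>
      \<exists>(V :: nat set) E. connected_graph V E \<and> card V = n \<and> card E = Suc m \<and> k < tmc V E"
  shows "g n k = m"
  unfolding g_def
proof (rule Max_eqI)
  fix m' assume m': "m' \<in> {m. m \<le> n choose 2 \<and>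
     (\<forall>(V :: nat set) E. connected_graph V E \<and> card V = n \<and> card E \<le> m \<longrightarrow> tmc V E \<le> k)}"
  show "m' \<le> m"
  proof (rule ccontr)
    assume "\<not> m' \<le> m"
    with m' lower show False by (fastforce simp: not_le)
  qed
qed (use assms in auto)

text \<open>More than \<open>k\<close> colors would leave at most \<open>t\<close> in the binomial
  of \<open>TMC_coloring_missing_edges_le\<close>, so at most \<open>t choose 2\<close> edges could
  be missing.\<close>

lemma tmc_le_if_few_edges:
  fixes V :: "'a::linorder set"
  assumes G: "connected_graph V E" and few: "card E + (t choose 2) < card V choose 2"
    and k: "card E + card V \<le> k + Suc t"
  shows "tmc V E \<le> k"
proof (rule tmc_le[OF G], rule ccontr)
  fix ce cv assume col: "TMC_coloring V E ce cv" and "\<not> card (ce ` E \<union> cv ` V) \<le> k"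
  then have "card E + card V - card (ce ` E \<union> cv ` V) \<le> t"
    using k by simp
  then have "(card E + card V - card (ce ` E \<union> cv ` V)) choose 2 \<le> t choose 2"
    by (rule choose_two_mono)
  moreover have "simple_graph V E" using G by (simp add: connected_graph_def)
  ultimately show False
    using TMC_coloring_missing_edges_le[OF _ col] few by simp
qed

text \<open>The \<open>(n choose 2) - m\<close> edges to delete fit inside a set of size
  \<open>t\<close>, and the star coloring uses \<open>m + n - t\<close> colors, more than
  \<open>k\<close>.\<close>

lemma exists_tmc_greater:
  assumes "t < n" and "(n choose 2) \<le> m + (t choose 2)" and "m \<le> n choose 2" and "k + t < m + n"
  shows "\<exists>(V :: nat set) E. connected_graph V E \<and> card V = n \<and> card E = m \<and> k < tmc V E"
proof -
  obtain V :: "nat set" and E where "connected_graph V E" "card V = n"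
    "card E = (n choose 2) - ((n choose 2) - m)" "card E + n - t \<le> tmc V E"
    using exists_graph_with_large_tmc[of t n "(n choose 2) - m"] assms(1,2) by fastforce
  then show ?thesis using assms by (intro exI[of _ V] exI[of _ E]) auto
qed

theorem theorem4:
  fixes n k :: nat
  assumes "n \<ge> 1" and "k \<ge> 1" and "n \<le> k" and "k \<le> (n choose 2) + n"
  shows "(\<forall>t::nat. 2 \<le> t \<and> t \<le> n - 1 \<longrightarrow>
            (((n - t) choose 2) + t * (n - t - 1) + n \<le> k \<and>
               k \<le> ((n - t) choose 2) + t * (n - t) + n - 2
               \<longrightarrow> g n k = k - n + t) \<and>
            (k = ((n - t) choose 2) + t * (n - t) + n - 1
               \<longrightarrow> g n k = k - n + t - 1))
       \<and> (k = (n choose 2) + n - 1 \<longrightarrow> g n k = (n choose 2) - 1)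
       \<and> (k = (n choose 2) + n \<longrightarrow> g n k = n choose 2)"
proof (intro conjI allI impI; (elim conjE)?)
  fix t :: nat
  assume t: "2 \<le> t" "t \<le> n - 1"
    and k: "((n - t) choose 2) + t * (n - t - 1) + n \<le> k"
      "k \<le> ((n - t) choose 2) + t * (n - t) + n - 2"
  obtain u where u: "t = Suc u" "1 \<le> u" "t < n"
    using t by (cases t) auto
  \<comment> \<open>\<open>P\<close> counts the pairs not inside a fixed set of size
    \<open>t\<close>. In these terms the range of \<open>k\<close> is
    \<open>P - t \<le> k - n \<le> P - 2\<close>.\<close>
  define P where "P = ((n - t) choose 2) + t * (n - t)"
  have n2: "n choose 2 = P + (t choose 2)"
    using choose_two_add[of "n - t" t] u by (simp add: P_def mult.commute)
  have t2: "t choose 2 = u + (u choose 2)"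
    by (simp add: u choose_two_Suc)
  have "n - t = Suc (n - t - 1)"
    using u by simp
  then have "t * (n - t) = t + t * (n - t - 1)"
    by (metis mult_Suc_right)
  then have k_ge: "P + n \<le> k + t"
    using k(1) unfolding P_def by linarith
  have k_le: "k + 2 \<le> P + n"
    using k(2) u unfolding P_def by linarith
  show "g n k = k - n + t"
  proof (rule g_eqI)
    show "k - n + t \<le> n choose 2"
      using n2 t2 k_le u assms by linarith
  next
    fix V :: "nat set" and E
    assume G: "connected_graph V E" "card V = n" "card E \<le> k - n + t"
    show "tmc V E \<le> k"
    proof (rule tmc_le_if_few_edges[OF G(1)])
      \<comment> \<open>By \<open>k_le\<close> there are at most \<open>P + u - 1\<close> edges, one
        short of \<open>P + u\<close>, so more than \<open>u choose 2\<close> are missing.\<close>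
      show "card E + (u choose 2) < card V choose 2" "card E + card V \<le> k + Suc u"
        unfolding G(2) using n2 t2 k_le u G(3) assms by linarith+
    qed
  next
    assume "k - n + t < n choose 2"
    then show "\<exists>(V :: nat set) E. connected_graph V E \<and> card V = n \<and> card E = Suc (k - n + t)
        \<and> k < tmc V E"
      using n2 u k_ge assms by (intro exists_tmc_greater[of t]) linarith+
  qed
next
  fix t :: nat
  assume t: "2 \<le> t" "t \<le> n - 1" and k: "k = ((n - t) choose 2) + t * (n - t) + n - 1"
  obtain u where u: "t = Suc u" "1 \<le> u" "t < n"
    using t by (cases t) auto
  define P where "P = ((n - t) choose 2) + t * (n - t)"
  have n2: "n choose 2 = P + (t choose 2)"
    using choose_two_add[of "n - t" t] u by (simp add: P_def mult.commute)
  have t2: "t choose 2 = u + (u choose 2)"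
    by (simp add: u choose_two_Suc)
  have kP: "k + 1 = P + n"
    using k u unfolding P_def by linarith
  show "g n k = k - n + t - 1"
  proof (rule g_eqI)
    show "k - n + t - 1 \<le> n choose 2"
      using n2 t2 kP u assms by linarith
  next
    fix V :: "nat set" and E
    assume G: "connected_graph V E" "card V = n" "card E \<le> k - n + t - 1"
    show "tmc V E \<le> k"
    proof (rule tmc_le_if_few_edges[OF G(1)])
      show "card E + (u choose 2) < card V choose 2" "card E + card V \<le> k + Suc u"
        unfolding G(2) using n2 t2 kP u G(3) assms by linarith+
    qed
  next
    assume "k - n + t - 1 < n choose 2"
    then show "\<exists>(V :: nat set) E. connected_graph V E \<and> card V = n
        \<and> card E = Suc (k - n + t - 1) \<and> k < tmc V E"
      \<comment> \<open>With \<open>P + u\<close> edges exactly \<open>u choose 2\<close> are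
        missing, so the construction works with \<open>u\<close> in place of \<open>t\<close> and
        gains a color. This lowers the value of \<open>g\<close> by one.\<close>
      using n2 t2 u kP assms by (intro exists_tmc_greater[of u]) linarith+
  qed
next
  assume k: "k = (n choose 2) + n - 1"
  show "g n k = (n choose 2) - 1"
  proof (rule g_eqI)
    fix V :: "nat set" and E
    assume G: "connected_graph V E" "card V = n" "card E \<le> (n choose 2) - 1"
    then have "simple_graph V E" by (simp add: connected_graph_def)
    \<comment> \<open>The trivial bound by edges plus vertices suffices. For \<open>n = 1\<close>
      the value \<open>k = 0\<close> would contradict \<open>n \<le> k\<close>, so the subtraction
      is not truncated.\<close>
    then show "tmc V E \<le> k"
      using G k assms by (intro tmc_le) (auto dest!: TMC_coloring_colors_le intro: order_trans)
  next
    assume "(n choose 2) - 1 < n choose 2"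
    \<comment> \<open>With \<open>t = 0\<close> nothing is deleted or merged: this is the complete
      graph with all colors distinct.\<close>
    then show "\<exists>(V :: nat set) E. connected_graph V E \<and> card V = n
        \<and> card E = Suc ((n choose 2) - 1) \<and> k < tmc V E"
      using k assms by (intro exists_tmc_greater[of 0]) auto
  qed simp
next
  assume k: "k = (n choose 2) + n"
  show "g n k = n choose 2"
  proof (rule g_eqI)
    fix V :: "nat set" and E
    assume G: "connected_graph V E" "card V = n" "card E \<le> n choose 2"
    then have "simple_graph V E" by (simp add: connected_graph_def)
    then show "tmc V E \<le> k"
      using G k by (intro tmc_le) (auto dest!: TMC_coloring_colors_le intro: order_trans)
  qed simp_all
qed

end
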